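(* Let $\ell\ge2$ be an integer, $\lambda\in(0,1)$ and $\tau:\mathbb{R}/\mathbb{Z}\to\mathbb{R}$ a continuous function. If $\Omega_{\lambda,\tau}$ is a closed topological annulus, then $\lambda>1/\ell$.
   Context: $A_{\lambda,\tau}:\mathbb{R}/\mathbb{Z}\times\mathbb{R}\to\mathbb{R}/\mathbb{Z}\times\mathbb{R}$ is $A_{\lambda,\tau}(\theta,t)=(\ell\theta,\lambda t+\tau(\theta))$, and $\Omega_{\lambda,\tau}$ is its non-wandering set. A closed topological annulus is a set homeomorphic to $\mathbb{R}/\mathbb{Z}\times[0,1]$. *)

theory Defs
  imports "HOL-Analysis.Analysis"
begin

quotient_type circle = real / "\<lambda>x y :: real. x - y \<in> \<int>"
proof (rule equivpI)
  show "reflp (\<lambda>x y :: real. x - y \<in> \<int>)"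
    by (simp add: reflp_def)
  show "symp (\<lambda>x y :: real. x - y \<in> \<int>)"
  proof (rule sympI)
    fix x y :: real
    assume "x - y \<in> \<int>"
    then have "- (x - y) \<in> \<int>" by (rule Ints_minus)
    then show "y - x \<in> \<int>" by simp
  qed
  show "transp (\<lambda>x y :: real. x - y \<in> \<int>)"
  proof (rule transpI)
    fix x y z :: real
    assume "x - y \<in> \<int>" "y - z \<in> \<int>"
    then have "(x - y) + (y - z) \<in> \<int>" by (rule Ints_add)
    then show "x - z \<in> \<int>" by simp
  qed
qed

text \<open>The topology on \<open>circle\<close> is the quotient topology.\<close>

instantiation circle :: topological_space
begin

definition open_circle :: "circle set \<Rightarrow> bool"
  where "open_circle U \<longleftrightarrow> open (abs_circle -` U)"

instance
proof
  show "open (UNIV :: circle set)"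
    by (simp add: open_circle_def)
  show "open (S \<inter> T)" if "open S" "open T" for S T :: "circle set"
    using that by (simp add: open_circle_def open_Int)
  show "open (\<Union>K)" if "\<forall>S\<in>K. open S" for K :: "circle set set"
    using that by (auto simp: open_circle_def vimage_Union)
qed

end

lift_definition circle_scale :: "int \<Rightarrow> circle \<Rightarrow> circle"
  is "\<lambda>k x. of_int k * x"
proof -
  fix k :: int and x y :: real
  assume "x - y \<in> \<int>"
  then have "of_int k * (x - y) \<in> \<int>" by (intro Ints_mult Ints_of_int)
  then show "of_int k * x - of_int k * y \<in> \<int>" by (simp add: right_diff_distrib)
qed

definition skew_map :: "int \<Rightarrow> real \<Rightarrow> (circle \<Rightarrow> real) \<Rightarrow> circle \<times> real \<Rightarrow> circle \<times> real"
  where "skew_map l lam \<tau> = (\<lambda>(\<theta>, t). (circle_scale l \<theta>, lam * t + \<tau> \<theta>))"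

definition nonwandering_set :: "('a::topological_space \<Rightarrow> 'a) \<Rightarrow> 'a set"
  where "nonwandering_set f =
    {x. \<forall>U. open U \<and> x \<in> U \<longrightarrow> (\<exists>n\<ge>1. (f ^^ n) ` U \<inter> U \<noteq> {})}"

definition closed_topological_annulus :: "'a::topological_space set \<Rightarrow> bool"
  where "closed_topological_annulus S \<longleftrightarrow>
    S homeomorphic (UNIV \<times> {0..1} :: (circle \<times> real) set)"

end

theory Submission imports Defs "HOL-Complex_Analysis.Winding_Numbers"
begin

text \<open>
  Suppose \<open>lam \<le> 1 / l\<close>. The non-wandering set \<open>\<Omega>\<close> satisfies \<open>A(\<Omega>) = \<Omega>\<close>, and \<open>A\<close>
  multiplies total area by at most \<open>lam * l \<le> 1\<close>, with a loss on overlaps; hence \<open>A\<close> is injective on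
  every open subset of \<open>\<Omega>\<close>, in particular on the open annulus inside \<open>\<Omega>\<close>. If the core curve of
  the annulus has degree \<open>d\<close> around the cylinder, its image is a Jordan curve of degree \<open>l * d\<close>;
  since Jordan curves have degree at most \<open>1\<close> in absolute value, \<open>d = 0\<close>. Hence the annulus lifts
  to a compact subset of the universal cover, and \<open>A\<close> lifts to a self-map of it that multiplies
  differences of angles by \<open>l\<close>. So the angle is constant, which contradicts invariance of domain.
\<close>

subsection \<open>Area\<close>

lemma emeasure_lborel_affine_image:
  fixes c d :: real
  assumes "S \<in> sets borel" "c > 0"
  shows "(\<lambda>s. c * s + d) ` S \<in> sets borel"
    and "emeasure lborel ((\<lambda>s. c * s + d) ` S) = ennreal c * emeasure lborel S"
proof -
  have eq: "(\<lambda>s. c * s + d) ` S = (\<lambda>t. (t - d) / c) -` S"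
    using assms(2) by (force simp: image_iff field_simps)
  show meas: "(\<lambda>s. c * s + d) ` S \<in> sets borel"
    unfolding eq using assms(1) by (intro measurable_sets_borel[of _ borel]) auto
  have "emeasure lborel ((\<lambda>s. c * s + d) ` S)
      = (\<integral>\<^sup>+ t. indicator ((\<lambda>s. c * s + d) ` S) t \<partial>lborel)"
    using meas by simp
  also have "\<dots> = \<bar>c\<bar> * (\<integral>\<^sup>+ s. indicator ((\<lambda>s. c * s + d) ` S) (d + c * s) \<partial>lborel)"
    using meas assms(2) by (intro nn_integral_real_affine) auto
  also have "\<dots> = c * (\<integral>\<^sup>+ s. indicator S s \<partial>lborel)"
    using assms(2) unfolding eq
    by (auto intro!: arg_cong[where f = "\<lambda>x. ennreal c * x"] nn_integral_cong simp: indicator_def)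
  finally show "emeasure lborel ((\<lambda>s. c * s + d) ` S) = ennreal c * emeasure lborel S"
    using assms(1) by simp
qed

text \<open>Subadditivity with \<open>S i \<union> S j\<close> kept as one piece, followed by
  inclusion-exclusion on that pair. This is how the loss of area on an overlap enters; the additive
  form avoids subtraction in \<open>ennreal\<close>.\<close>

lemma emeasure_UN_plus_Int_le:
  assumes "finite I" "i \<in> I" "j \<in> I" "i \<noteq> j" "\<And>k. k \<in> I \<Longrightarrow> S k \<in> sets M"
  shows "emeasure M (\<Union>k\<in>I. S k) + emeasure M (S i \<inter> S j) \<le> (\<Sum>k\<in>I. emeasure M (S k))"
proof -
  let ?J = "I - {i, j}"
  have "(\<Union>k\<in>I. S k) = (S i \<union> S j) \<union> (\<Union>k\<in>?J. S k)"
    using assms by auto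
  moreover have "S i \<union> S j \<in> sets M" "(\<Union>k\<in>?J. S k) \<in> sets M"
    using assms by (auto intro!: sets.finite_UN)
  ultimately have "emeasure M (\<Union>k\<in>I. S k)
      \<le> emeasure M (S i \<union> S j) + emeasure M (\<Union>k\<in>?J. S k)"
    by (simp only: emeasure_subadditive)
  also have "\<dots> \<le> emeasure M (S i \<union> S j) + (\<Sum>k\<in>?J. emeasure M (S k))"
    using assms by (intro add_left_mono emeasure_subadditive_finite) auto
  finally have "emeasure M (\<Union>k\<in>I. S k) + emeasure M (S i \<inter> S j)
      \<le> (emeasure M (S i \<union> S j) + (\<Sum>k\<in>?J. emeasure M (S k))) + emeasure M (S i \<inter> S j)"
    by (rule add_right_mono)
  also have "\<dots> = (emeasure M (S i \<union> S j) + emeasure M (S i \<inter> S j)) + (\<Sum>k\<in>?J. emeasure M (S k))"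
    by (simp only: ac_simps)
  also have "\<dots> = (\<Sum>k\<in>{i, j}. emeasure M (S k)) + (\<Sum>k\<in>?J. emeasure M (S k))"
    using assms by (simp add: emeasure_Un_Int[symmetric])
  also have "\<dots> = (\<Sum>k\<in>?J. emeasure M (S k)) + (\<Sum>k\<in>{i, j}. emeasure M (S k))"
    by (rule add.commute)
  also have "\<dots> = (\<Sum>k\<in>I. emeasure M (S k))"
    by (rule sum.subset_diff[symmetric]) (use assms in auto)
  finally show ?thesis .
qed

text \<open>The branch \<open>x \<mapsto> (x + k) / n\<close> carries \<open>[0, 1)\<close> onto the
  \<open>k\<close>-th of \<open>n\<close> intervals that tile \<open>[0, 1)\<close>, and the change
  of variables contributes the factor \<open>n\<close> each time.\<close>

lemma nn_integral_inverse_branches: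
  fixes f :: "real \<Rightarrow> ennreal" and n :: nat
  assumes [measurable]: "f \<in> borel_measurable borel" and n: "n > 0"
  shows "(\<Sum>k<n. \<integral>\<^sup>+x. f ((x + real k) / real n) * indicator {0..<1} x \<partial>lborel)
       = ennreal (real n) * (\<integral>\<^sup>+x. f x * indicator {0..<1} x \<partial>lborel)"
proof -
  let ?I = "\<lambda>k::nat. {real k / real n..<(real k + 1) / real n}"
  have piece: "(\<integral>\<^sup>+x. f ((x + real k) / real n) * indicator {0..<1} x \<partial>lborel)
      = ennreal (real n) * (\<integral>\<^sup>+x. f x * indicator (?I k) x \<partial>lborel)" for k
  proof -
    have "(\<integral>\<^sup>+x. f ((x + real k) / real n) * indicator {0..<1} x \<partial>lborel)
      = ennreal \<bar>real n\<bar> * (\<integral>\<^sup>+x. f ((- real k + real n * x + real k) / real n) *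
          indicator {0..<1} (- real k + real n * x) \<partial>lborel)"
      using n by (intro nn_integral_real_affine) auto
    also have "\<dots> = ennreal (real n) * (\<integral>\<^sup>+x. f x * indicator (?I k) x \<partial>lborel)"
      using n by (auto intro!: arg_cong[where f = "\<lambda>x. ennreal (real n) * x"] nn_integral_cong
          simp: indicator_def field_simps)
    finally show ?thesis .
  qed
  have ind: "(\<Sum>k<n. indicator (?I k) x) = (indicator {0..<1} x :: ennreal)" for x :: real
  proof (cases "0 \<le> x \<and> x < 1")
    case True
    \<comment> \<open>The index of the only tile that contains \<open>x\<close>.\<close>
    define q where "q = nat \<lfloor>real n * x\<rfloor>"
    have q: "real q \<le> real n * x" "real n * x < real q + 1"
      using True by (simp_all add: q_def)
    have "real n * x < real n"
      using True n by simp
    then have "q < n"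
      using q by linarith
    have iff: "x \<in> ?I k \<longleftrightarrow> k = q" for k
    proof -
      have "x \<in> ?I k \<longleftrightarrow> real k \<le> real n * x \<and> real n * x < real k + 1"
        using n by (auto simp: field_simps)
      also have "\<dots> \<longleftrightarrow> k = q"
      proof
        assume "real k \<le> real n * x \<and> real n * x < real k + 1"
        then have "real k < real q + 1" "real q < real k + 1"
          using q by linarith+
        then show "k = q"
          by linarith
      qed (use q in simp)
      finally show ?thesis .
    qed
    have "(\<Sum>k<n. indicator (?I k) x) = (\<Sum>k<n. if k = q then 1 else 0 :: ennreal)"
      by (intro sum.cong refl) (simp only: indicator_def iff of_bool_def)
    with \<open>q < n\<close> True show ?thesis
      by simp
  next
    case False
    have "x \<notin> ?I k" if "k < n" for k
    proof
      assume "x \<in> ?I k"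
      then have "0 \<le> x \<and> x < (real k + 1) / real n"
        by (auto intro: order_trans[rotated])
      moreover have "(real k + 1) / real n \<le> 1"
        using that by (simp add: field_simps)
      ultimately show False
        using False by linarith
    qed
    then show ?thesis
      using False by (auto simp: indicator_def)
  qed
  have "(\<Sum>k<n. \<integral>\<^sup>+x. f ((x + real k) / real n) * indicator {0..<1} x \<partial>lborel)
      = ennreal (real n) * (\<integral>\<^sup>+x. (\<Sum>k<n. f x * indicator (?I k) x) \<partial>lborel)"
    unfolding piece by (subst nn_integral_sum) (auto simp: sum_distrib_left)
  also have "\<dots> = ennreal (real n) * (\<integral>\<^sup>+x. f x * indicator {0..<1} x \<partial>lborel)"
    by (simp only: ind sum_distrib_left[symmetric])
  finally show ?thesis .
qed

text \<open>Compare areas over the fundamental domain \<open>[0, 1)\<close>, slice by slice. Each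
  vertical slice of \<open>X\<close> is covered by copies, shrunk by \<open>c\<close>, of the slices
  over the \<open>n\<close> preimages of its base point. If two of these copies shared a box,
  integration would give \<open>M + (area) \<le> c * n * M \<le> M\<close> for the area
  \<open>M\<close> of \<open>X\<close>, which is finite by the height bound.\<close>

lemma inverse_branch_images_no_common_box:
  fixes X :: "(real \<times> real) set" and n i j :: nat and c R \<delta> x0 t0 :: real and \<sigma> :: "real \<Rightarrow> real"
  assumes X: "X \<in> sets borel" and bound: "\<And>x t. (x, t) \<in> X \<Longrightarrow> \<bar>t\<bar> \<le> R"
    and c: "0 < c" "c * real n \<le> 1"
    and inv: "\<And>x t. (x, t) \<in> X \<Longrightarrow>
      \<exists>k<n. \<exists>s. ((x + real k) / real n, s) \<in> X \<and> t = c * s + \<sigma> ((x + real k) / real n)"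
    and ij: "i < n" "j < n" "i \<noteq> j" and x0: "0 \<le> x0" "x0 < 1" and \<delta>: "\<delta> > 0"
    and common: "\<And>x t k. \<bar>x - x0\<bar> < \<delta> \<Longrightarrow> \<bar>t - t0\<bar> < \<delta> \<Longrightarrow> k \<in> {i, j} \<Longrightarrow>
      \<exists>s. ((x + real k) / real n, s) \<in> X \<and> t = c * s + \<sigma> ((x + real k) / real n)"
  shows False
proof -
  define m where "m x = emeasure lborel (Pair x -` X)" for x :: real
  define S where "S x k = (\<lambda>s. c * s + \<sigma> ((x + real k) / real n)) ` (Pair ((x + real k) / real n) -` X)"
    for x and k :: nat
  \<comment> \<open>The overlap is used only over \<open>[x0, x0 + e)\<close>: this lies to the
    right of \<open>x0\<close>, which may be \<open>0\<close>, and does not leave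
    \<open>[0, 1)\<close>.\<close>
  define e where "e = min \<delta> (1 - x0)"
  have e: "e > 0" "e \<le> \<delta>" "x0 + e \<le> 1"
    using \<delta> x0 by (auto simp: e_def)
  have n: "n > 0"
    using ij by simp
  have [measurable]: "X \<in> sets (borel \<Otimes>\<^sub>M borel)"
    using X by (simp only: borel_prod)
  have slice: "Pair x -` X \<in> sets borel" for x
    by (rule sets_Pair1) measurable
  have m_meas [measurable]: "m \<in> borel_measurable borel"
    unfolding m_def by (rule lborel.measurable_emeasure_Pair) measurable
  have S_sets: "S x k \<in> sets lborel" for x k
    unfolding S_def using emeasure_lborel_affine_image(1)[OF slice c(1)] by simp
  have S_emeasure: "emeasure lborel (S x k) = ennreal c * m ((x + real k) / real n)" for x k
    unfolding S_def m_def by (rule emeasure_lborel_affine_image(2)[OF slice c(1)])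
  \<comment> \<open>The extra term is the height of the common box, which the sum on the right
    counts twice.\<close>
  have m_le: "m x + ennreal (2 * \<delta>) * indicator {x0..<x0 + e} x
      \<le> (\<Sum>k<n. ennreal c * m ((x + real k) / real n))" for x
  proof -
    have "Pair x -` X \<subseteq> (\<Union>k<n. S x k)"
    proof
      fix t assume "t \<in> Pair x -` X"
      then have "\<exists>k<n. \<exists>s. ((x + real k) / real n, s) \<in> X \<and> t = c * s + \<sigma> ((x + real k) / real n)"
        by (intro inv) simp
      then show "t \<in> (\<Union>k<n. S x k)"
        unfolding S_def by blast
    qed
    then have "m x \<le> emeasure lborel (\<Union>k<n. S x k)"
      unfolding m_def using S_sets by (intro emeasure_mono) auto
    moreover have "ennreal (2 * \<delta>) * indicator {x0..<x0 + e} x \<le> emeasure lborel (S x i \<inter> S x j)"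
    proof (cases "x \<in> {x0..<x0 + e}")
      case True
      have "{t0 - \<delta><..<t0 + \<delta>} \<subseteq> S x i \<inter> S x j"
      proof
        fix t assume "t \<in> {t0 - \<delta><..<t0 + \<delta>}"
        then have "\<bar>t - t0\<bar> < \<delta>"
          by auto
        moreover have "\<bar>x - x0\<bar> < \<delta>"
          using True e by auto
        ultimately have "\<exists>s. ((x + real k) / real n, s) \<in> X \<and> t = c * s + \<sigma> ((x + real k) / real n)"
          if "k \<in> {i, j}" for k
          using that by (intro common)
        then have "t \<in> S x k" if "k \<in> {i, j}" for k
          using that unfolding S_def by blast
        then show "t \<in> S x i \<inter> S x j"
          by simp
      qed
      then have "emeasure lborel {t0 - \<delta><..<t0 + \<delta>} \<le> emeasure lborel (S x i \<inter> S x j)"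
        using S_sets by (intro emeasure_mono sets.Int)
      moreover have "t0 + \<delta> - (t0 - \<delta>) = 2 * \<delta>"
        by simp
      ultimately show ?thesis
        using True \<delta> by simp
    qed simp
    ultimately have "m x + ennreal (2 * \<delta>) * indicator {x0..<x0 + e} x
        \<le> emeasure lborel (\<Union>k<n. S x k) + emeasure lborel (S x i \<inter> S x j)"
      by (rule add_mono)
    also have "\<dots> \<le> (\<Sum>k<n. emeasure lborel (S x k))"
      using ij S_sets by (intro emeasure_UN_plus_Int_le) auto
    finally show ?thesis
      by (simp add: S_emeasure)
  qed
  define M where "M = (\<integral>\<^sup>+x. m x * indicator {0..<1} x \<partial>lborel)"
  have "M + ennreal (2 * \<delta>) * ennreal e
      = (\<integral>\<^sup>+x. m x * indicator {0..<1} x + ennreal (2 * \<delta>) * indicator {x0..<x0 + e} x \<partial>lborel)"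
    unfolding M_def using e by (subst nn_integral_add) (auto simp: nn_integral_cmult)
  also have "\<dots> \<le> (\<integral>\<^sup>+x. (\<Sum>k<n. ennreal c * (m ((x + real k) / real n) * indicator {0..<1} x)) \<partial>lborel)"
  proof (rule nn_integral_mono)
    fix x :: real
    show "m x * indicator {0..<1} x + ennreal (2 * \<delta>) * indicator {x0..<x0 + e} x
      \<le> (\<Sum>k<n. ennreal c * (m ((x + real k) / real n) * indicator {0..<1} x))"
      using m_le[of x] e x0 by (auto simp: indicator_def split: if_splits)
  qed
  also have "\<dots> = ennreal c * (\<Sum>k<n. \<integral>\<^sup>+x. m ((x + real k) / real n) * indicator {0..<1} x \<partial>lborel)"
    by (subst nn_integral_sum) (auto simp: nn_integral_cmult sum_distrib_left)
  also have "\<dots> = ennreal (c * real n) * M"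
    unfolding M_def nn_integral_inverse_branches[OF m_meas n]
    using c by (simp add: ennreal_mult mult.assoc)
  also have "\<dots> \<le> 1 * M"
    using c by (intro mult_right_mono) auto
  finally have le: "M + ennreal (2 * \<delta>) * ennreal e \<le> M"
    by simp
  \<comment> \<open>Finiteness of \<open>M\<close> permits its cancellation in \<open>le\<close>.
    The maximum covers a negative \<open>R\<close>, which can occur for empty
    \<open>X\<close>.\<close>
  have "m x \<le> ennreal (2 * max R 0)" for x
  proof -
    have "Pair x -` X \<subseteq> {- max R 0..max R 0}"
      using bound by fastforce
    then have "m x \<le> emeasure lborel {- max R 0..max R 0}"
      unfolding m_def by (intro emeasure_mono) auto
    moreover have "max R 0 - - max R 0 = 2 * max R 0"
      by simp
    ultimately show ?thesis
      by (simp only: emeasure_lborel_Icc_eq) simp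
  qed
  then have "M \<le> (\<integral>\<^sup>+x. ennreal (2 * max R 0) * indicator {0..<1::real} x \<partial>lborel)"
    unfolding M_def by (intro nn_integral_mono mult_right_mono) auto
  also have "\<dots> < \<infinity>"
    by (simp add: nn_integral_cmult ennreal_mult_less_top)
  finally have "M < \<infinity>" .
  with le have "ennreal (2 * \<delta>) * ennreal e \<le> 0"
    using ennreal_add_left_cancel_le[of M "ennreal (2 * \<delta>) * ennreal e" 0] by auto
  then show False
    using \<delta> e by (simp add: ennreal_mult[symmetric])
qed

subsection \<open>The skew product and its non-wandering set\<close>

lemma abs_circle_eq_iff: "abs_circle x = abs_circle y \<longleftrightarrow> x - y \<in> \<int>"
  by (rule circle.abs_eq_iff)

lemma surj_abs_circle: "\<exists>x. \<theta> = abs_circle x"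
  by (metis Quotient_circle Quotient_abs_rep)

lemma continuous_on_abs_circle: "continuous_on S abs_circle"
  by (rule continuous_on_subset[of UNIV])
    (auto simp: continuous_on_open_vimage open_circle_def)

text \<open>In the quotient topology the question is about the preimage of the image, which is the
  union of the integer translates of \<open>U\<close>.\<close>

lemma open_abs_circle_image:
  assumes "open U"
  shows "open (abs_circle ` U)"
proof -
  have "abs_circle -` (abs_circle ` U) = (\<Union>k::int. (\<lambda>x. x + of_int k) -` U)"
  proof (intro set_eqI iffI)
    fix x assume "x \<in> abs_circle -` (abs_circle ` U)"
    then obtain u where "u \<in> U" "u - x \<in> \<int>"
      by (metis abs_circle_eq_iff imageE vimageE)
    then obtain k :: int where "u = x + of_int k"
      by (metis Ints_cases add.commute diff_add_cancel)
    with \<open>u \<in> U\<close> show "x \<in> (\<Union>k::int. (\<lambda>x. x + of_int k) -` U)"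
      by auto
  next
    fix x assume "x \<in> (\<Union>k::int. (\<lambda>x. x + of_int k) -` U)"
    then obtain k :: int where k: "x + of_int k \<in> U"
      by auto
    have "abs_circle x = abs_circle (x + of_int k)"
      by (simp add: abs_circle_eq_iff)
    with k show "x \<in> abs_circle -` (abs_circle ` U)"
      by auto
  qed
  then show ?thesis
    unfolding open_circle_def
    using assms by (auto intro!: open_vimage continuous_intros)
qed

lemma open_circle_times_real_image:
  fixes W :: "(real \<times> real) set"
  assumes "open W"
  shows "open ((\<lambda>(x, t). (abs_circle x, t)) ` W)"
proof (rule open_prod_intro)
  fix q assume "q \<in> (\<lambda>(x, t). (abs_circle x, t)) ` W"
  then obtain x t where xt: "(x, t) \<in> W" "q = (abs_circle x, t)"
    by auto
  obtain A B where AB: "open A" "open B" "(x, t) \<in> A \<times> B" "A \<times> B \<subseteq> W"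
    using assms xt(1) by (rule open_prod_elim)
  have "abs_circle ` A \<times> B = (\<lambda>(x, t). (abs_circle x, t)) ` (A \<times> B)"
    by force
  with AB(4) have "abs_circle ` A \<times> B \<subseteq> (\<lambda>(x, t). (abs_circle x, t)) ` W"
    by (metis image_mono)
  moreover have "q \<in> abs_circle ` A \<times> B"
    using AB(3) xt(2) by simp
  ultimately show "\<exists>A B. open A \<and> open B \<and> q \<in> A \<times> B \<and> A \<times> B \<subseteq> (\<lambda>(x, t). (abs_circle x, t)) ` W"
    using AB(1,2) open_abs_circle_image by blast
qed

text \<open>Branches are taken on \<open>\<real> \<times> \<real>\<close>: on the circle they would be permuted by \<open>x \<mapsto> x + 1\<close>.\<close>

definition inverse_branch :: "nat \<Rightarrow> real \<Rightarrow> (circle \<Rightarrow> real) \<Rightarrow> nat \<Rightarrow> real \<times> real \<Rightarrow> circle \<times> real"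
  where "inverse_branch n c \<tau> k =
    (\<lambda>(x, t). (abs_circle ((x + real k) / real n), (t - \<tau> (abs_circle ((x + real k) / real n))) / c))"

text \<open>The angle equation reads \<open>n * z = x + j\<close> with an integer \<open>j\<close>;
  modulo \<open>1\<close>, only the residue of \<open>j\<close> modulo \<open>n\<close> affects
  \<open>z\<close>. So the \<open>n\<close> branches enumerate the whole fibre.\<close>

lemma skew_map_eq_iff:
  assumes n: "n > 0" and c: "c \<noteq> 0"
  shows "skew_map (int n) c \<tau> y = (abs_circle x, t) \<longleftrightarrow> (\<exists>k<n. y = inverse_branch n c \<tau> k (x, t))"
proof -
  obtain z s where y: "y = (abs_circle z, s)"
    by (metis surj_abs_circle surj_pair)
  have "circle_scale (int n) (abs_circle z) = abs_circle x \<longleftrightarrow>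
    (\<exists>k<n. abs_circle z = abs_circle ((x + real k) / real n))"
  proof
    assume "circle_scale (int n) (abs_circle z) = abs_circle x"
    then obtain j :: int where j: "real n * z = x + of_int j"
      by (auto simp: circle_scale.abs_eq abs_circle_eq_iff Ints_def algebra_simps)
    define k where "k = nat (j mod int n)"
    have k: "k < n" "j = int k + int n * (j div int n)"
      using n by (auto simp: k_def nat_less_iff)
    then have "real n * z = x + real k + real n * of_int (j div int n)"
      using j by (metis of_int_add of_int_mult of_int_of_nat_eq add.assoc)
    then have "z - (x + real k) / real n = of_int (j div int n)"
      using n by (simp add: field_simps)
    then show "\<exists>k<n. abs_circle z = abs_circle ((x + real k) / real n)"
      using k(1) by (metis Ints_of_int abs_circle_eq_iff)
  next
    assume "\<exists>k<n. abs_circle z = abs_circle ((x + real k) / real n)"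
    then obtain k where k: "abs_circle z = abs_circle ((x + real k) / real n)"
      by auto
    show "circle_scale (int n) (abs_circle z) = abs_circle x"
      unfolding k using n by (simp add: circle_scale.abs_eq abs_circle_eq_iff)
  qed
  moreover have "c * s + \<tau> (abs_circle z) = t \<longleftrightarrow> s = (t - \<tau> (abs_circle z)) / c"
    using c by (auto simp: field_simps)
  ultimately show ?thesis
    unfolding y skew_map_def inverse_branch_def case_prod_conv prod.inject by metis
qed

lemma continuous_on_inverse_branch:
  assumes "continuous_on UNIV \<tau>"
  shows "continuous_on UNIV (inverse_branch n c \<tau> k)"
  unfolding inverse_branch_def case_prod_unfold divide_inverse
  by (intro continuous_intros continuous_on_compose2[OF assms]
      continuous_on_compose2[OF continuous_on_abs_circle[of UNIV]]) auto

section \<open>Continuity of the skew product and invariance of its non-wandering set\<close>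

lemma continuous_on_circle_scale: "continuous_on UNIV (circle_scale k)"
proof -
  have "open (circle_scale k -` U)" if "open U" for U
  proof -
    have "abs_circle -` (circle_scale k -` U) = (\<lambda>x. abs_circle (of_int k * x)) -` U"
      by (auto simp: circle_scale.abs_eq)
    moreover have "continuous_on UNIV (\<lambda>x. abs_circle (of_int k * x))"
      by (intro continuous_on_compose2[OF continuous_on_abs_circle[of UNIV]] continuous_intros) auto
    ultimately show ?thesis
      using that by (simp add: open_circle_def open_vimage)
  qed
  then show ?thesis
    by (simp add: continuous_on_open_vimage)
qed

lemma continuous_on_skew_map:
  assumes "continuous_on UNIV \<tau>"
  shows "continuous_on UNIV (skew_map l c \<tau>)"
  unfolding skew_map_def case_prod_unfold
  by (intro continuous_intros continuous_on_compose2[OF assms]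
      continuous_on_compose2[OF continuous_on_circle_scale]) auto

lemma nonwandering_set_image:
  assumes f: "continuous_on UNIV f" and x: "x \<in> nonwandering_set f"
  shows "f x \<in> nonwandering_set f"
  unfolding nonwandering_set_def
proof (intro CollectI allI impI)
  fix U assume "open U \<and> f x \<in> U"
  then have "open (f -` U) \<and> x \<in> f -` U"
    using f by (auto intro: open_vimage)
  with x obtain n where "n \<ge> 1" "(f ^^ n) ` (f -` U) \<inter> f -` U \<noteq> {}"
    unfolding nonwandering_set_def by blast
  then obtain z where "f z \<in> U" "f ((f ^^ n) z) \<in> U"
    by auto
  then have "(f ^^ n) (f z) \<in> (f ^^ n) ` U \<inter> U"
    by (simp add: funpow_swap1)
  with \<open>n \<ge> 1\<close> show "\<exists>n\<ge>1. (f ^^ n) ` U \<inter> U \<noteq> {}"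
    by blast
qed

text \<open>This gives the inclusion of \<Omega> in its image. If every preimage had a wandering
  neighbourhood \<open>V k\<close>, then a neighbourhood of the point whose branch images all lie in
  the corresponding \<open>V k\<close> would still return to itself. Moving the returning orbit
  segment one step into the past makes some \<open>V k\<close> return as well.\<close>

lemma nonwandering_set_skew_map_preimage:
  assumes n: "n > 0" and c: "c \<noteq> 0" and \<tau>: "continuous_on UNIV \<tau>"
    and x: "(abs_circle x, t) \<in> nonwandering_set (skew_map (int n) c \<tau>)"
  shows "\<exists>k<n. inverse_branch n c \<tau> k (x, t) \<in> nonwandering_set (skew_map (int n) c \<tau>)"
proof (rule ccontr)
  let ?A = "skew_map (int n) c \<tau>" and ?b = "inverse_branch n c \<tau>"
  assume "\<not> ?thesis"
  then have "\<forall>k\<in>{..<n}. \<exists>V. open V \<and> ?b k (x, t) \<in> V \<and> (\<forall>m\<ge>1. (?A ^^ m) ` V \<inter> V = {})"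
    unfolding nonwandering_set_def by auto
  then obtain V where V: "\<And>k. k < n \<Longrightarrow> open (V k)" "\<And>k. k < n \<Longrightarrow> ?b k (x, t) \<in> V k"
    "\<And>k m. k < n \<Longrightarrow> m \<ge> 1 \<Longrightarrow> (?A ^^ m) ` V k \<inter> V k = {}"
    by (metis bchoice lessThan_iff)
  \<comment> \<open>\<open>W\<close> is taken in the plane, where the branches are defined, and is
    then projected by the open map \<open>Q\<close>.\<close>
  define W where "W = (\<Inter>k<n. ?b k -` V k)"
  define Q :: "real \<times> real \<Rightarrow> circle \<times> real" where "Q = (\<lambda>(x, t). (abs_circle x, t))"
  have "open W"
    unfolding W_def using V(1) continuous_on_inverse_branch[OF \<tau>]
    by (intro open_INT) (auto intro: open_vimage)
  then have "open (Q ` W)"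
    unfolding Q_def by (rule open_circle_times_real_image)
  moreover have "(abs_circle x, t) \<in> Q ` W"
    using V(2) by (force simp: W_def Q_def)
  ultimately obtain m where m: "m \<ge> 1" "(?A ^^ m) ` (Q ` W) \<inter> Q ` W \<noteq> {}"
    using x unfolding nonwandering_set_def by blast
  then obtain y where "y \<in> (?A ^^ m) ` (Q ` W)" "y \<in> Q ` W"
    by blast
  then obtain w w' where "w \<in> W" "w' \<in> W" "y = (?A ^^ m) (Q w)" "y = Q w'"
    by blast
  then have w: "w \<in> W" "w' \<in> W" "(?A ^^ m) (Q w) = Q w'"
    by simp_all
  obtain m' where m': "m = Suc m'"
    using m(1) by (cases m) auto
  have "?A ((?A ^^ m') (Q w)) = Q w'"
    using w(3) m' by simp
  \<comment> \<open>The last point before the return lies on some branch \<open>k\<close> over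
    \<open>w'\<close>. Starting from the same branch over \<open>w\<close>, the orbit reaches that
    point after exactly \<open>m\<close> steps.\<close>
  then obtain k where k: "k < n" "(?A ^^ m') (Q w) = ?b k w'"
    using skew_map_eq_iff[OF n c, of \<tau> "(?A ^^ m') (Q w)" "fst w'" "snd w'"]
    by (auto simp: Q_def case_prod_unfold)
  have "?A (?b k w) = Q w"
    using skew_map_eq_iff[OF n c, of \<tau> "?b k w" "fst w" "snd w"] k(1)
    by (auto simp: Q_def case_prod_unfold)
  then have "(?A ^^ m) (?b k w) = ?b k w'"
    using k(2) m' by (simp add: funpow_swap1)
  moreover have "?b k w \<in> V k" "?b k w' \<in> V k"
    using w k(1) by (auto simp: W_def)
  ultimately have "?b k w' \<in> (?A ^^ m) ` V k \<inter> V k"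
    by (metis IntI image_eqI)
  then show False
    by (simp only: V(3)[OF k(1) m(1)] empty_iff)
qed

text \<open>Two distinct points of \<open>U\<close> with the same image lie on two different
  branches over one base point. As \<open>U\<close> is open, both branches send a whole box around
  that base point into \<Omega>, which the area estimate excludes. Closedness supplies measurability
  and \<open>R\<close> supplies finite area.\<close>

lemma inj_on_skew_map_open_subset_nonwandering:
  fixes n :: nat and c R :: real and \<tau> :: "circle \<Rightarrow> real"
  defines "\<Omega> \<equiv> nonwandering_set (skew_map (int n) c \<tau>)"
  assumes n: "n > 0" and c: "0 < c" "c * real n \<le> 1" and \<tau>: "continuous_on UNIV \<tau>"
    and closed: "closed {(x, t). (abs_circle x, t) \<in> \<Omega>}"
    and bound: "\<And>\<theta> t. (\<theta>, t) \<in> \<Omega> \<Longrightarrow> \<bar>t\<bar> \<le> R"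
    and U: "open U" "U \<subseteq> \<Omega>"
  shows "inj_on (skew_map (int n) c \<tau>) U"
proof (rule inj_onI, rule ccontr)
  let ?A = "skew_map (int n) c \<tau>" and ?b = "inverse_branch n c \<tau>"
  fix u v assume uv: "u \<in> U" "v \<in> U" "?A u = ?A v" "u \<noteq> v"
  obtain x where x: "fst (?A u) = abs_circle x"
    using surj_abs_circle by blast
  \<comment> \<open>The representative in \<open>[0, 1)\<close> is chosen to fit the fundamental
    domain of the area estimate.\<close>
  define x0 t0 where "x0 = frac x" and "t0 = snd (?A u)"
  have x0: "0 \<le> x0" "x0 < 1"
    by (simp_all add: x0_def frac_lt_1)
  have "abs_circle x = abs_circle x0"
    by (simp add: abs_circle_eq_iff x0_def frac_def)
  then have Au: "?A u = (abs_circle x0, t0)" "?A v = (abs_circle x0, t0)"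
    using x uv(3) by (simp_all add: t0_def prod_eq_iff)
  obtain i where i: "i < n" "u = ?b i (x0, t0)"
    using Au(1) skew_map_eq_iff[OF n, of c \<tau> u x0 t0] c(1) by auto
  obtain j where j: "j < n" "v = ?b j (x0, t0)"
    using Au(2) skew_map_eq_iff[OF n, of c \<tau> v x0 t0] c(1) by auto
  define W where "W = ?b i -` U \<inter> ?b j -` U"
  have "open W"
    unfolding W_def using U(1) continuous_on_inverse_branch[OF \<tau>]
    by (intro open_Int) (auto intro: open_vimage)
  moreover have "(x0, t0) \<in> W"
    using uv i j by (simp add: W_def)
  ultimately obtain A B where AB: "open A" "open B" "(x0, t0) \<in> A \<times> B" "A \<times> B \<subseteq> W"
    by (rule open_prod_elim)
  obtain d1 where d1: "d1 > 0" "\<And>x. \<bar>x - x0\<bar> < d1 \<Longrightarrow> x \<in> A"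
    using AB(1,3) unfolding open_real by auto
  obtain d2 where d2: "d2 > 0" "\<And>t. \<bar>t - t0\<bar> < d2 \<Longrightarrow> t \<in> B"
    using AB(2,3) unfolding open_real by auto
  let ?X = "{(x, t). (abs_circle x, t) \<in> \<Omega>}"
  have branch: "\<exists>s. ((x + real k) / real n, s) \<in> ?X \<and> t = c * s + \<tau> (abs_circle ((x + real k) / real n))"
    if "?b k (x, t) \<in> \<Omega>" for x t k
    using that c(1) by (intro exI[of _ "snd (?b k (x, t))"]) (auto simp: inverse_branch_def)
  show False
  proof (rule inverse_branch_images_no_common_box[of ?X R c n "\<lambda>x. \<tau> (abs_circle x)" i j x0 "min d1 d2" t0])
    show "?X \<in> sets borel"
      using closed by (rule borel_closed)
    show "\<bar>t\<bar> \<le> R" if "(x, t) \<in> ?X" for x t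
      using that bound by simp
    show "\<exists>k<n. \<exists>s. ((x + real k) / real n, s) \<in> ?X \<and> t = c * s + \<tau> (abs_circle ((x + real k) / real n))"
      if "(x, t) \<in> ?X" for x t
    proof -
      have "(abs_circle x, t) \<in> nonwandering_set ?A"
        using that by (simp add: \<Omega>_def)
      with n c(1) \<tau> have "\<exists>k<n. ?b k (x, t) \<in> \<Omega>"
        unfolding \<Omega>_def by (intro nonwandering_set_skew_map_preimage) auto
      then show ?thesis
        using branch by meson
    qed
    show "i \<noteq> j"
      using uv(4) i j by auto
    show "\<exists>s. ((x + real k) / real n, s) \<in> ?X \<and> t = c * s + \<tau> (abs_circle ((x + real k) / real n))"
      if "\<bar>x - x0\<bar> < min d1 d2" "\<bar>t - t0\<bar> < min d1 d2" "k \<in> {i, j}" for x t k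
    proof -
      have "(x, t) \<in> W"
        using that d1(2)[of x] d2(2)[of t] AB(4) by auto
      then have "?b k (x, t) \<in> \<Omega>"
        using that(3) U(2) by (auto simp: W_def)
      then show ?thesis
        by (rule branch)
    qed
  qed (use c i j x0 d1 d2 in auto)
qed

subsection \<open>The universal cover of the cylinder\<close>

lift_definition circle_cis :: "circle \<Rightarrow> complex" is "\<lambda>x. cis (2 * pi * x)"
proof -
  fix x y :: real
  assume "x - y \<in> \<int>"
  then obtain k :: int where "x = y + of_int k"
    by (metis Ints_cases add.commute diff_add_cancel)
  then have "cis (2 * pi * x) = cis (2 * pi * y) * cis (2 * pi * of_int k)"
    by (simp only: cis_mult distrib_left)
  then show "cis (2 * pi * x) = cis (2 * pi * y)"
    by (simp only: cis_multiple_2pi Ints_of_int mult_1_right)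
qed

text \<open>Identifies the cylinder with the punctured plane, so that logarithms and winding numbers
  about \<open>0\<close> become available.\<close>

definition cylinder_embed :: "circle \<times> real \<Rightarrow> complex"
  where "cylinder_embed = (\<lambda>(\<theta>, t). of_real (exp t) * circle_cis \<theta>)"

text \<open>The universal covering of the cylinder, normalised so that following it by
  \<open>cylinder_embed\<close> gives \<open>exp\<close>: the real part is the height and the
  imaginary part is \<open>2 * pi\<close> times the angle.\<close>

definition cylinder_cover :: "complex \<Rightarrow> circle \<times> real"
  where "cylinder_cover z = (abs_circle (Im z / (2 * pi)), Re z)"

lemma cylinder_embed_cover: "cylinder_embed (cylinder_cover z) = exp z"
  by (simp add: cylinder_embed_def cylinder_cover_def circle_cis.abs_eq exp_eq_polar)

lemma cylinder_cover_Complex: "cylinder_cover (Complex t (2 * pi * x)) = (abs_circle x, t)"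
  by (simp add: cylinder_cover_def)

lemma surj_cylinder_cover: "\<exists>z. q = cylinder_cover z"
  by (metis cylinder_cover_Complex surj_abs_circle surj_pair)

lemma cylinder_embed_nonzero: "cylinder_embed q \<noteq> 0"
  using surj_cylinder_cover[of q] by (auto simp: cylinder_embed_cover)

lemma cylinder_cover_eq_iff: "cylinder_cover z = cylinder_cover w \<longleftrightarrow> exp z = exp w"
proof
  assume "exp z = exp w"
  then obtain k :: int where k: "z = w + of_int (2 * k) * of_real pi * \<i>"
    by (auto simp: exp_eq)
  have "Im z / (2 * pi) - Im w / (2 * pi) = of_int k" "Re z = Re w"
    by (auto simp: k field_simps)
  then show "cylinder_cover z = cylinder_cover w"
    by (simp add: cylinder_cover_def abs_circle_eq_iff)
qed (metis cylinder_embed_cover)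

lemma continuous_on_circle_cis: "continuous_on UNIV circle_cis"
proof -
  have "open (circle_cis -` U)" if "open U" for U
  proof -
    have "abs_circle -` (circle_cis -` U) = (\<lambda>x. cis (2 * pi * x)) -` U"
      by (auto simp: circle_cis.abs_eq)
    moreover have "open ((\<lambda>x. cis (2 * pi * x)) -` U)"
      using that by (intro open_vimage continuous_intros)
    ultimately show ?thesis
      by (simp add: open_circle_def)
  qed
  then show ?thesis
    by (simp add: continuous_on_open_vimage)
qed

lemma continuous_on_cylinder_embed: "continuous_on S cylinder_embed"
proof (rule continuous_on_subset)
  show "continuous_on UNIV cylinder_embed"
    unfolding cylinder_embed_def case_prod_unfold
    by (intro continuous_intros continuous_on_compose2[OF continuous_on_circle_cis]) auto
qed simp

lemma continuous_on_cylinder_cover: "continuous_on S cylinder_cover"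
  unfolding cylinder_cover_def divide_inverse
  by (intro continuous_intros continuous_on_compose2[OF continuous_on_abs_circle[of UNIV]]) auto

lemma open_cylinder_cover_image:
  assumes "open V"
  shows "open (cylinder_cover ` V)"
proof -
  let ?f = "\<lambda>(x, t). Complex t (2 * pi * x)"
  have "open (?f -` V)"
    using assms unfolding case_prod_unfold
    by (intro open_vimage) (auto simp: Complex_eq intro!: continuous_intros)
  then have "open ((\<lambda>(x, t). (abs_circle x, t)) ` (?f -` V))"
    by (rule open_circle_times_real_image)
  also have "(\<lambda>(x, t). (abs_circle x, t)) ` (?f -` V) = cylinder_cover ` V"
  proof (intro equalityI subsetI)
    fix q assume "q \<in> (\<lambda>(x, t). (abs_circle x, t)) ` (?f -` V)"
    then obtain x t where "q = (abs_circle x, t)" "Complex t (2 * pi * x) \<in> V"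
      by auto
    then show "q \<in> cylinder_cover ` V"
      by (metis cylinder_cover_Complex image_eqI)
  next
    fix q assume "q \<in> cylinder_cover ` V"
    then obtain z where z: "z \<in> V" "q = cylinder_cover z"
      by auto
    show "q \<in> (\<lambda>(x, t). (abs_circle x, t)) ` (?f -` V)"
      unfolding z(2) cylinder_cover_def
      by (rule image_eqI[of _ _ "(Im z / (2 * pi), Re z)"]) (use z(1) in simp_all)
  qed
  finally show ?thesis .
qed

text \<open>The values lie in the discrete set of integer multiples of \<open>2 * pi * \<i>\<close>.
  Applied to a difference, this says that two continuous lifts of one map on a connected set differ
  by a constant.\<close>

lemma exp_eq_one_imp_constant_on:
  fixes f :: "'a::topological_space \<Rightarrow> complex"
  assumes "connected S" "continuous_on S f" "\<And>x. x \<in> S \<Longrightarrow> exp (f x) = 1"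
  shows "f constant_on S"
proof (rule continuous_discrete_range_constant[OF assms(1,2)])
  fix x assume x: "x \<in> S"
  have "2 * pi \<le> norm (f y - f x)" if y: "y \<in> S" "f y \<noteq> f x" for y
  proof (rule ccontr)
    assume "\<not> ?thesis"
    then have "\<bar>Im (f y) - Im (f x)\<bar> < 2 * pi"
      using abs_Im_le_cmod[of "f y - f x"] by simp
    moreover have "exp (f y) = exp (f x)"
      by (simp only: assms(3) x y(1))
    ultimately have "f y = f x"
      by (rule exp_complex_eqI)
    with y(2) show False ..
  qed
  then show "\<exists>e>0. \<forall>y. y \<in> S \<and> f y \<noteq> f x \<longrightarrow> e \<le> norm (f y - f x)"
    by (intro exI[of _ "2 * pi"]) auto
qed

text \<open>On the cover the angle is multiplied by \<open>l\<close> without reduction modulo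
  \<open>1\<close>, so differences of imaginary parts scale exactly by \<open>l\<close>.\<close>

definition skew_map_lift :: "int \<Rightarrow> real \<Rightarrow> (circle \<Rightarrow> real) \<Rightarrow> complex \<Rightarrow> complex"
  where "skew_map_lift l c \<tau> w = Complex (c * Re w + \<tau> (fst (cylinder_cover w))) (of_int l * Im w)"

lemma cylinder_cover_skew_map_lift:
  "cylinder_cover (skew_map_lift l c \<tau> w) = skew_map l c \<tau> (cylinder_cover w)"
  by (simp add: skew_map_lift_def skew_map_def cylinder_cover_def circle_scale.abs_eq)

lemma continuous_on_skew_map_lift:
  assumes "continuous_on UNIV \<tau>"
  shows "continuous_on S (skew_map_lift l c \<tau>)"
  unfolding skew_map_lift_def Complex_eq
  by (intro continuous_intros continuous_on_compose2[OF assms]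
      continuous_on_cylinder_cover) auto

subsection \<open>Embedded annuli\<close>

text \<open>The preimage of the standard annulus \<open>UNIV \<times> {0..1}\<close> under
  \<open>cylinder_cover\<close>.\<close>

definition strip :: "complex set"
  where "strip = {z. 0 \<le> Re z \<and> Re z \<le> 1}"

lemma convex_strip: "convex strip"
  unfolding strip_def
  by (simp add: Collect_conj_eq convex_Int convex_halfspace_Re_ge convex_halfspace_Re_le)

text \<open>\<open>h\<close> parametrises an embedded annulus and \<open>G\<close> is its lift to
  the universal covers; the topology of \<open>h\<close> is accessed through the continuity of
  \<open>G\<close>.\<close>

locale annulus_lift =
  fixes h :: "circle \<times> real \<Rightarrow> circle \<times> real" and G :: "complex \<Rightarrow> complex"
  assumes inj: "inj_on h (UNIV \<times> {0..1})"
    and cont: "continuous_on strip G"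
    and lift: "\<And>z. z \<in> strip \<Longrightarrow> h (cylinder_cover z) = cylinder_cover (G z)"
begin

text \<open>This is injectivity of \<open>h\<close> seen on the covers, whose fibres are those of
  \<open>exp\<close>.\<close>

lemma exp_lift_eq_iff:
  assumes "z \<in> strip" "w \<in> strip"
  shows "exp (G z) = exp (G w) \<longleftrightarrow> exp z = exp w"
proof -
  have "cylinder_cover z \<in> UNIV \<times> {0..1}" "cylinder_cover w \<in> UNIV \<times> {0..1}"
    using assms by (auto simp: strip_def cylinder_cover_def)
  then have "cylinder_cover (G z) = cylinder_cover (G w) \<longleftrightarrow> cylinder_cover z = cylinder_cover w"
    using lift assms inj by (metis inj_onD)
  then show ?thesis
    by (simp add: cylinder_cover_eq_iff)
qed

lemma image_eq: "h ` (UNIV \<times> {0..1}) = cylinder_cover ` G ` strip"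
proof -
  have "UNIV \<times> {0..1} = cylinder_cover ` strip"
  proof (intro equalityI subsetI)
    fix q :: "circle \<times> real" assume "q \<in> UNIV \<times> {0..1}"
    moreover obtain z where "q = cylinder_cover z"
      using surj_cylinder_cover by blast
    ultimately show "q \<in> cylinder_cover ` strip"
      by (auto simp: strip_def cylinder_cover_def)
  qed (auto simp: strip_def cylinder_cover_def)
  then show ?thesis
    using lift by (force simp: image_image)
qed

text \<open>A compact fundamental domain of the strip under translation by
  \<open>2 * pi * \<i>\<close>, with both horizontal edges included.\<close>

definition rect :: "complex set"
  where "rect = cbox 0 (Complex 1 (2 * pi))"

lemma rect_subset: "rect \<subseteq> strip"
  by (auto simp: rect_def strip_def in_cbox_complex_iff)

lemma compact_image_rect: "compact (G ` rect)"
  using cont rect_subset unfolding rect_def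
  by (intro compact_continuous_image compact_cbox) (auto intro: continuous_on_subset)

lemma rect_representative:
  assumes "z \<in> strip"
  obtains w where "w \<in> rect" "exp z = exp w"
proof
  define k where "k = \<lfloor>Im z / (2 * pi)\<rfloor>"
  let ?w = "z - of_int (2 * k) * of_real pi * \<i>"
  have "of_int k * (2 * pi) \<le> Im z" "Im z < (of_int k + 1) * (2 * pi)"
    unfolding k_def by (simp_all add: pos_le_divide_eq[symmetric] pos_divide_less_eq[symmetric])
  then show "?w \<in> rect"
    using assms by (auto simp: rect_def strip_def in_cbox_complex_iff algebra_simps)
  show "exp z = exp ?w"
    unfolding exp_eq by (intro exI[of _ k]) simp
qed

lemma exp_image_rect: "exp ` G ` strip = exp ` G ` rect"
proof
  show "exp ` G ` strip \<subseteq> exp ` G ` rect"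
  proof (clarify)
    fix z assume z: "z \<in> strip"
    then obtain w where w: "w \<in> rect" "exp z = exp w"
      by (rule rect_representative)
    then have "exp (G z) = exp (G w)"
      using z rect_subset by (subst exp_lift_eq_iff) auto
    with w(1) show "exp (G z) \<in> exp ` G ` rect"
      by simp
  qed
qed (use rect_subset in auto)

lemma cylinder_cover_in_image_iff:
  "cylinder_cover w \<in> h ` (UNIV \<times> {0..1}) \<longleftrightarrow> exp w \<in> exp ` G ` rect"
  unfolding image_eq exp_image_rect[symmetric] image_iff bex_simps cylinder_cover_eq_iff ..

text \<open>In the punctured plane the annulus becomes the compact set \<open>exp\<close> G
  \<open>rect\<close>, so pulling it back along a continuous map gives a closed set.\<close>

lemma closed_image_vimage: "closed {(x, t). (abs_circle x, t) \<in> h ` (UNIV \<times> {0..1})}"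
proof -
  have "compact (exp ` G ` rect)"
    by (rule compact_continuous_image[OF _ compact_image_rect]) (intro continuous_intros)
  then have "closed ((\<lambda>(x, t). exp (Complex t (2 * pi * x))) -` (exp ` G ` rect))"
    unfolding case_prod_unfold
    by (intro closed_vimage) (auto simp: Complex_eq compact_imp_closed intro!: continuous_intros)
  also have "(\<lambda>(x, t). exp (Complex t (2 * pi * x))) -` (exp ` G ` rect)
      = {(x, t). (abs_circle x, t) \<in> h ` (UNIV \<times> {0..1})}"
    unfolding cylinder_cover_Complex[symmetric] cylinder_cover_in_image_iff by auto
  finally show ?thesis .
qed

lemma bounded_image:
  obtains R where "\<And>\<theta> t. (\<theta>, t) \<in> h ` (UNIV \<times> {0..1}) \<Longrightarrow> \<bar>t\<bar> \<le> R"
proof -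
  obtain R where R: "\<And>w. w \<in> G ` rect \<Longrightarrow> norm w \<le> R"
    using compact_imp_bounded[OF compact_image_rect] unfolding bounded_iff by blast
  have "\<bar>t\<bar> \<le> R" if t: "(\<theta>, t) \<in> h ` (UNIV \<times> {0..1})" for \<theta> t
  proof -
    obtain w where w: "(\<theta>, t) = cylinder_cover w"
      using surj_cylinder_cover by blast
    then have "exp w \<in> exp ` G ` rect"
      using t cylinder_cover_in_image_iff by simp
    then obtain v where v: "v \<in> G ` rect" "exp w = exp v"
      by blast
    then have "(\<theta>, t) = cylinder_cover v"
      by (simp add: w cylinder_cover_eq_iff)
    then have "t = Re v"
      by (simp add: cylinder_cover_def)
    then show ?thesis
      using R[OF v(1)] abs_Re_le_cmod[of v] by linarith
  qed
  then show thesis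
    by (rule that)
qed

text \<open>\<open>G\<close> may fail to be injective on the whole open strip, but it is injective
  on every window of height \<open>2 * pi\<close>, because \<open>exp\<close> is. Invariance of
  domain applies to each window, and the windows cover the strip.\<close>

lemma open_image: "open (G ` {z. 0 < Re z \<and> Re z < 1})"
proof -
  let ?D = "\<lambda>a. {z. 0 < Re z \<and> Re z < 1 \<and> a < Im z \<and> Im z < a + 2 * pi}"
  have "open (G ` ?D a)" for a
  proof (rule invariance_of_domain)
    show "continuous_on (?D a) G"
      by (rule continuous_on_subset[OF cont]) (auto simp: strip_def)
    have "?D a = {z. 0 < Re z} \<inter> {z. Re z < 1} \<inter> {z. a < Im z} \<inter> {z. Im z < a + 2 * pi}"
      by auto
    then show "open (?D a)"
      by (simp add: open_Int open_halfspace_Re_gt open_halfspace_Re_lt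
          open_halfspace_Im_gt open_halfspace_Im_lt)
    show "inj_on G (?D a)"
    proof (rule inj_onI)
      fix z w assume zw: "z \<in> ?D a" "w \<in> ?D a" "G z = G w"
      have "\<bar>Im z - Im w\<bar> < 2 * pi"
        using zw(1,2) unfolding mem_Collect_eq by linarith
      moreover have "exp z = exp w"
        using zw by (subst exp_lift_eq_iff[symmetric]) (auto simp: strip_def)
      ultimately show "z = w"
        by (rule exp_complex_eqI)
    qed
  qed
  moreover have "G ` {z. 0 < Re z \<and> Re z < 1} = (\<Union>a. G ` ?D a)"
  proof -
    have "{z. 0 < Re z \<and> Re z < 1} = (\<Union>a. ?D a)"
    proof (intro equalityI subsetI)
      fix z assume "z \<in> {z. 0 < Re z \<and> Re z < 1}"
      then have "z \<in> ?D (Im z - pi)"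
        by auto
      then show "z \<in> (\<Union>a. ?D a)"
        by blast
    qed auto
    then show ?thesis
      by auto
  qed
  ultimately show ?thesis
    by auto
qed

section \<open>The degree of the core curve\<close>

text \<open>Injectivity of the skew product on the open annulus makes the image of the core curve a
  Jordan curve, which winds around \<open>0\<close> at most once in absolute value. Its winding
  number is also \<open>l * k\<close>, where \<open>k\<close> is the degree of the core curve, so
  \<open>l \<ge> 2\<close> forces \<open>k = 0\<close>.\<close>

lemma core_curve_lift_closed:
  assumes l: "l \<ge> 2" and \<tau>: "continuous_on UNIV \<tau>"
    and inj_A: "inj_on (skew_map l c \<tau>) (cylinder_cover ` G ` {z. 0 < Re z \<and> Re z < 1})"
  shows "G (Complex (1 / 2) (2 * pi)) = G (Complex (1 / 2) 0)"
proof -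
  define \<gamma> where "\<gamma> s = G (Complex (1 / 2) (2 * pi * s))" for s
  let ?L = "skew_map_lift l c \<tau>"
  have path_\<gamma>: "path \<gamma>"
    unfolding path_def \<gamma>_def
    by (intro continuous_on_compose2[OF cont]) (auto simp: strip_def Complex_eq intro!: continuous_intros)
  have path_L: "path (?L \<circ> \<gamma>)"
    using path_\<gamma> continuous_on_skew_map_lift[OF \<tau>] by (rule path_continuous_image)
  have eq_iff: "exp (?L (\<gamma> x)) = exp (?L (\<gamma> y)) \<longleftrightarrow> x - y \<in> \<int>" for x y
  proof -
    have "exp (?L (\<gamma> x)) = exp (?L (\<gamma> y)) \<longleftrightarrow> 
        skew_map l c \<tau> (cylinder_cover (\<gamma> x)) = skew_map l c \<tau> (cylinder_cover (\<gamma> y))"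
      by (simp only: cylinder_cover_eq_iff[symmetric] cylinder_cover_skew_map_lift)
    also have "\<dots> \<longleftrightarrow> cylinder_cover (\<gamma> x) = cylinder_cover (\<gamma> y)"
      by (rule inj_on_eq_iff[OF inj_A]) (auto simp: \<gamma>_def intro!: imageI)
    also have "\<dots> \<longleftrightarrow> cylinder_cover (Complex (1 / 2) (2 * pi * x)) = cylinder_cover (Complex (1 / 2) (2 * pi * y))"
      unfolding cylinder_cover_eq_iff \<gamma>_def by (rule exp_lift_eq_iff) (auto simp: strip_def)
    also have "\<dots> \<longleftrightarrow> x - y \<in> \<int>"
      by (simp add: cylinder_cover_Complex abs_circle_eq_iff)
    finally show ?thesis .
  qed
  have "simple_path (exp \<circ> (?L \<circ> \<gamma>))"
    unfolding simple_path_def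
  proof
    show "path (exp \<circ> (?L \<circ> \<gamma>))"
      by (intro path_continuous_image path_L continuous_intros)
    show "loop_free (exp \<circ> (?L \<circ> \<gamma>))"
      unfolding loop_free_def
    proof (intro ballI impI)
      fix x y :: real
      assume xy: "x \<in> {0..1}" "y \<in> {0..1}" "(exp \<circ> (?L \<circ> \<gamma>)) x = (exp \<circ> (?L \<circ> \<gamma>)) y"
      then obtain k :: int where "x - y = of_int k"
        using eq_iff by (auto elim: Ints_cases)
      moreover from this have "k = 0 \<or> k = 1 \<or> k = -1"
        using xy by auto
      ultimately show "x = y \<or> x = 0 \<and> y = 1 \<or> x = 1 \<and> y = 0"
        using xy by auto
    qed
  qed
  moreover have "pathfinish (exp \<circ> (?L \<circ> \<gamma>)) = pathstart (exp \<circ> (?L \<circ> \<gamma>))"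
    by (simp add: pathfinish_def pathstart_def eq_iff)
  moreover have "0 \<notin> path_image (exp \<circ> (?L \<circ> \<gamma>))"
    by (auto simp: path_image_def)
  ultimately have "winding_number (exp \<circ> (?L \<circ> \<gamma>)) 0 \<in> {-1, 0, 1}"
    by (rule simple_closed_path_winding_number_cases)
  \<comment> \<open>The lifted path is a logarithm of the curve, so its increment computes the
    winding number.\<close>
  then have "(?L (\<gamma> 1) - ?L (\<gamma> 0)) / (2 * of_real pi * \<i>) \<in> {-1, 0, 1}"
    by (simp add: winding_number_compose_exp[OF path_L] pathfinish_def pathstart_def)
  then have "?L (\<gamma> 1) - ?L (\<gamma> 0) \<in> {- (2 * of_real pi * \<i>), 0, 2 * of_real pi * \<i>}"
    by (auto simp: divide_eq_eq)
  then have "Im (?L (\<gamma> 1) - ?L (\<gamma> 0)) \<in> Im ` {- (2 * of_real pi * \<i>), 0, 2 * of_real pi * \<i>}"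
    by (rule imageI)
  then have "Im (?L (\<gamma> 1) - ?L (\<gamma> 0)) \<in> {- 2 * pi, 0, 2 * pi}"
    by simp
  \<comment> \<open>\<open>k\<close> is the degree of the core curve; \<open>skew_map_lift\<close>
    turns the imaginary increment \<open>2 * pi * k\<close> into
    \<open>2 * pi * l * k\<close>.\<close>
  moreover obtain k :: int where k: "\<gamma> 1 = \<gamma> 0 + of_int (2 * k) * of_real pi * \<i>"
  proof -
    have "exp (\<gamma> 1) = exp (\<gamma> 0)"
      unfolding \<gamma>_def by (subst exp_lift_eq_iff) (auto simp: strip_def exp_eq_polar)
    then show thesis
      using that by (auto simp: exp_eq)
  qed
  ultimately have "2 * pi * (of_int l * of_int k) \<in> {2 * pi * (- 1), 2 * pi * 0, 2 * pi * 1}"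
    by (simp add: skew_map_lift_def algebra_simps)
  then have "real_of_int (l * k) \<in> {- 1, 0, 1}"
    by (simp only: insert_iff mult_cancel_left empty_iff) auto
  then have "\<bar>real_of_int (l * k)\<bar> \<le> 1"
    by auto
  then have "\<bar>l * k\<bar> \<le> 1"
    by linarith
  then have "l * \<bar>k\<bar> \<le> 1"
    using l by (simp add: abs_mult)
  moreover have "2 * \<bar>k\<bar> \<le> l * \<bar>k\<bar>"
    using l by (intro mult_right_mono) auto
  ultimately have "k = 0"
    by linarith
  then show ?thesis
    using k by (simp add: \<gamma>_def)
qed

text \<open>The increment of \<open>G\<close> over one period is a multiple of
  \<open>2 * pi * \<i>\<close>, hence constant on the connected strip, and the core curve shows that
  it is \<open>0\<close>.\<close>

lemma lift_periodic:
  assumes core: "G (Complex (1 / 2) (2 * pi)) = G (Complex (1 / 2) 0)"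
    and zw: "z \<in> strip" "w \<in> strip" "exp z = exp w"
  shows "G z = G w"
proof -
  let ?p = "2 * of_real pi * \<i>"
  have shift: "z + ?p \<in> strip" if "z \<in> strip" for z
    using that by (simp add: strip_def)
  have "(\<lambda>z. G (z + ?p) - G z) constant_on strip"
  proof (rule exp_eq_one_imp_constant_on)
    show "connected strip"
      using convex_strip by (rule convex_connected)
    show "continuous_on strip (\<lambda>z. G (z + ?p) - G z)"
      using shift by (intro continuous_intros cont continuous_on_compose2[OF cont]) auto
    show "exp (G (z + ?p) - G z) = 1" if "z \<in> strip" for z
    proof -
      have "exp (G (z + ?p)) = exp (G z)"
        using that shift by (subst exp_lift_eq_iff) (auto simp: exp_add)
      then show ?thesis
        by (simp add: exp_diff)
    qed
  qed
  then obtain d where d: "\<And>z. z \<in> strip \<Longrightarrow> G (z + ?p) - G z = d"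
    unfolding constant_on_def by blast
  have "Complex (1 / 2) 0 + ?p = Complex (1 / 2) (2 * pi)"
    by (simp add: complex_eq_iff)
  then have "d = 0"
    using d[of "Complex (1 / 2) 0"] core by (simp add: strip_def)
  then have step: "G (z + ?p) = G z" if "z \<in> strip" for z
    using d[OF that] by simp
  have multiple: "G (z + of_nat m * ?p) = G z" if "z \<in> strip" for z m
  proof (induction m)
    case (Suc m)
    have "z + of_nat m * ?p \<in> strip"
      using that by (simp add: strip_def)
    then show ?case
      using step[of "z + of_nat m * ?p"] Suc.IH by (simp add: algebra_simps)
  qed simp
  obtain k :: int where k: "z = w + of_int (2 * k) * of_real pi * \<i>"
    using zw(3) by (auto simp: exp_eq)
  show ?thesis
  proof (cases "k \<ge> 0")
    case True
    then have "z = w + of_nat (nat k) * ?p"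
      by (simp add: k)
    then show ?thesis
      using multiple[OF zw(2)] by metis
  next
    case False
    then have "w = z + of_nat (nat (- k)) * ?p"
      by (simp add: k)
    then show ?thesis
      using multiple[OF zw(1)] by metis
  qed
qed

text \<open>If \<open>G\<close> were periodic, its image would be a compact set \<open>K\<close>
  mapped bijectively onto the annulus. The skew product would then induce a self-map of
  \<open>K\<close> stretching imaginary parts by \<open>l \<ge> 2\<close>, so \<open>K\<close> would
  have imaginary width \<open>0\<close>, although it contains a nonempty open set.\<close>

lemma core_curve_lift_not_closed:
  assumes l: "l \<ge> 2" and \<tau>: "continuous_on UNIV \<tau>"
    and invariant: "skew_map l c \<tau> ` h ` (UNIV \<times> {0..1}) \<subseteq> h ` (UNIV \<times> {0..1})"
  shows "G (Complex (1 / 2) (2 * pi)) \<noteq> G (Complex (1 / 2) 0)"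
proof
  assume core: "G (Complex (1 / 2) (2 * pi)) = G (Complex (1 / 2) 0)"
  let ?L = "skew_map_lift l c \<tau>"
  define K where "K = G ` rect"
  have K_eq: "K = G ` strip"
  proof
    show "G ` strip \<subseteq> K"
    proof (rule image_subsetI)
      fix z assume z: "z \<in> strip"
      then obtain w where w: "w \<in> rect" "exp z = exp w"
        by (rule rect_representative)
      then have "G z = G w"
        using z rect_subset by (intro lift_periodic[OF core]) auto
      with w(1) show "G z \<in> K"
        by (simp add: K_def)
    qed
  qed (use rect_subset in \<open>auto simp: K_def\<close>)
  have compact: "compact K"
    unfolding K_def by (rule compact_image_rect)
  have inj_exp: "inj_on exp K"
  proof (rule inj_onI)
    fix a b assume ab: "a \<in> K" "b \<in> K" "exp a = exp b"
    then obtain z w where zw: "z \<in> strip" "w \<in> strip" "a = G z" "b = G w"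
      unfolding K_eq by blast
    then have "exp z = exp w"
      using ab(3) exp_lift_eq_iff by simp
    then show "a = b"
      unfolding zw(3,4) by (rule lift_periodic[OF core zw(1,2)])
  qed
  \<comment> \<open>The skew product transported to \<open>K\<close>. Unlike \<open>?L\<close>, it
    takes values in \<open>K\<close>.\<close>
  define T where "T w = the_inv_into K exp (exp (?L w))" for w
  have exp_L: "exp (?L w) \<in> exp ` K" if "w \<in> K" for w
  proof -
    have "cylinder_cover w \<in> h ` (UNIV \<times> {0..1})"
      using that by (auto simp: image_eq K_eq)
    then have "cylinder_cover (?L w) \<in> h ` (UNIV \<times> {0..1})"
      using invariant by (auto simp: cylinder_cover_skew_map_lift)
    then show ?thesis
      by (simp add: cylinder_cover_in_image_iff K_def)
  qed
  have T: "T w \<in> K" "exp (T w) = exp (?L w)" if "w \<in> K" for w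
    unfolding T_def using inj_exp exp_L[OF that]
    by (auto intro: the_inv_into_into f_the_inv_into_f)
  \<comment> \<open>\<open>?L\<close> and \<open>T\<close> lift the same map, and \<open>T\<close>
    is continuous because \<open>exp\<close> has a continuous inverse on the compact set
    \<open>K\<close>.\<close>
  have "(\<lambda>w. ?L w - T w) constant_on K"
  proof (rule exp_eq_one_imp_constant_on)
    show "connected K"
      unfolding K_def rect_def
      using cont rect_subset by (intro connected_continuous_image convex_connected convex_box)
        (auto simp: rect_def intro: continuous_on_subset)
    have "continuous_on (exp ` K) (the_inv_into K exp)"
      by (intro continuous_on_inv_into compact inj_exp continuous_intros)
    then have "continuous_on K T"
      unfolding T_def
      by (rule continuous_on_compose2)
        (use exp_L in \<open>auto intro!: continuous_intros continuous_on_skew_map_lift \<tau>\<close>)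
    then show "continuous_on K (\<lambda>w. ?L w - T w)"
      by (intro continuous_intros continuous_on_skew_map_lift \<tau>)
    show "exp (?L w - T w) = 1" if "w \<in> K" for w
      using T(2)[OF that] by (simp add: exp_diff)
  qed
  then obtain d where d: "\<And>w. w \<in> K \<Longrightarrow> ?L w - T w = d"
    unfolding constant_on_def by blast
  have Im_T: "Im (T w) = of_int l * Im w - Im d" if "w \<in> K" for w
    using arg_cong[OF d[OF that], of Im] by (simp add: skew_map_lift_def)
  have "K \<noteq> {}"
    by (auto simp: K_eq strip_def intro: exI[of _ 0])
  have cont_Im: "continuous_on K Im"
    by (intro continuous_intros)
  obtain u where u: "u \<in> K" "\<And>w. w \<in> K \<Longrightarrow> Im w \<le> Im u"
    using continuous_attains_sup[OF compact \<open>K \<noteq> {}\<close> cont_Im] by blast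
  obtain v where v: "v \<in> K" "\<And>w. w \<in> K \<Longrightarrow> Im v \<le> Im w"
    using continuous_attains_inf[OF compact \<open>K \<noteq> {}\<close> cont_Im] by blast
  \<comment> \<open>\<open>u\<close> and \<open>v\<close> realise the imaginary width of
    \<open>K\<close>. Their images stay in \<open>K\<close>, so the stretched width cannot exceed
    the original one.\<close>
  have "Im (T u) - Im (T v) = of_int l * (Im u - Im v)"
    by (simp only: Im_T u(1) v(1)) (simp add: algebra_simps)
  moreover have "Im (T u) - Im (T v) \<le> Im u - Im v"
    using u(2)[OF T(1)[OF u(1)]] v(2)[OF T(1)[OF v(1)]] by linarith
  moreover have "2 * (Im u - Im v) \<le> of_int l * (Im u - Im v)"
    using u(2)[OF v(1)] l by (intro mult_right_mono) auto
  ultimately have "2 * (Im u - Im v) \<le> Im u - Im v"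
    by (simp only: order_trans)
  then have "Im u \<le> Im v"
    by simp
  then have flat: "Im w = Im v" if "w \<in> K" for w
    using u(2)[OF that] v(2)[OF that] by linarith
  define V where "V = G ` {z. 0 < Re z \<and> Re z < 1}"
  have "V \<subseteq> K"
    unfolding V_def K_eq by (rule image_mono) (auto simp: strip_def)
  have "G (Complex (1 / 2) 0) \<in> V"
    unfolding V_def by (rule imageI) simp
  then obtain e where e: "e > 0" "ball (G (Complex (1 / 2) 0)) e \<subseteq> V"
    using open_image unfolding V_def[symmetric] by (meson openE)
  define w where "w = G (Complex (1 / 2) 0)"
  \<comment> \<open>A vertical displacement by half the radius stays inside the ball but changes the
    imaginary part.\<close>
  have "w \<in> K" "w + of_real (e / 2) * \<i> \<in> K"
    using e \<open>V \<subseteq> K\<close> by (auto simp: w_def dist_norm norm_mult subset_iff)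
  then have "Im w = Im (w + of_real (e / 2) * \<i>)"
    using flat by metis
  then show False
    using e(1) by simp
qed

end

theorem proposition4p4:
  fixes l :: int and lam :: real and \<tau> :: "circle \<Rightarrow> real"
  assumes "l \<ge> 2"
    and "0 < lam" and "lam < 1"
    and "continuous_on UNIV \<tau>"
    and "closed_topological_annulus (nonwandering_set (skew_map l lam \<tau>))"
  shows "lam > 1 / of_int l"
proof (rule ccontr)
  assume "\<not> lam > 1 / of_int l"
  \<comment> \<open>The borderline value is included: the strict loss of area comes from overlaps,
    not from the factor \<open>lam * l\<close>.\<close>
  with assms(1) have small: "lam * of_int l \<le> 1"
    by (simp add: field_simps not_less)
  let ?A = "skew_map l lam \<tau>"
  let ?\<Omega> = "nonwandering_set ?A"
  obtain f h :: "circle \<times> real \<Rightarrow> circle \<times> real"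
    where fh: "homeomorphism ?\<Omega> (UNIV \<times> {0..1}) f h"
    using assms(5) unfolding closed_topological_annulus_def homeomorphic_def by auto
  then have h: "continuous_on (UNIV \<times> {0..1}) h" "h ` (UNIV \<times> {0..1}) = ?\<Omega>"
    "inj_on h (UNIV \<times> {0..1})"
    unfolding homeomorphism_def by (auto intro: inj_on_inverseI[of _ f])
  have cover_strip: "cylinder_cover z \<in> UNIV \<times> {0..1}" if "z \<in> strip" for z
    using that by (auto simp: strip_def cylinder_cover_def)
  have "continuous_on strip (\<lambda>z. h (cylinder_cover z))"
    by (rule continuous_on_compose2[OF h(1) continuous_on_cylinder_cover])
      (intro image_subsetI cover_strip)
  then have "continuous_on strip (\<lambda>z. cylinder_embed (h (cylinder_cover z)))"
    by (rule continuous_on_compose2[OF continuous_on_cylinder_embed[of UNIV]]) simp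
  \<comment> \<open>The strip is contractible, so a nowhere vanishing continuous function on it has
    a continuous logarithm; this produces the lift of \<open>h\<close>.\<close>
  then obtain G where G: "continuous_on strip G"
    "\<And>z. z \<in> strip \<Longrightarrow> cylinder_embed (h (cylinder_cover z)) = exp (G z)"
    using cylinder_embed_nonzero convex_strip by (metis (no_types, lifting) continuous_logarithm_on_contractible
        convex_imp_contractible)
  interpret annulus_lift h G
  proof
    fix z assume "z \<in> strip"
    moreover obtain w where "h (cylinder_cover z) = cylinder_cover w"
      using surj_cylinder_cover by blast
    ultimately show "h (cylinder_cover z) = cylinder_cover (G z)"
      using G(2) by (metis cylinder_embed_cover cylinder_cover_eq_iff)
  qed (use h G in auto)
  let ?U = "cylinder_cover ` G ` {z. 0 < Re z \<and> Re z < 1}"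
  obtain R where R: "\<And>\<theta> t. (\<theta>, t) \<in> ?\<Omega> \<Longrightarrow> \<bar>t\<bar> \<le> R"
    using bounded_image unfolding h(2) by blast
  define n where "n = nat l"
  have l: "l = int n"
    using assms(1) by (simp add: n_def)
  have "inj_on ?A ?U"
    unfolding l
  proof (rule inj_on_skew_map_open_subset_nonwandering)
    show "closed {(x, t). (abs_circle x, t) \<in> nonwandering_set (skew_map (int n) lam \<tau>)}"
      using closed_image_vimage unfolding h(2) l .
    show "?U \<subseteq> nonwandering_set (skew_map (int n) lam \<tau>)"
      unfolding l[symmetric] h(2)[symmetric] image_eq by (intro image_mono) (auto simp: strip_def)
    show "open ?U"
      by (intro open_cylinder_cover_image open_image)
  qed (use assms small R l in auto)
  then have "G (Complex (1 / 2) (2 * pi)) = G (Complex (1 / 2) 0)"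
    using assms(1,4) by (intro core_curve_lift_closed)
  moreover have "?A ` ?\<Omega> \<subseteq> ?\<Omega>"
    using nonwandering_set_image[OF continuous_on_skew_map[OF assms(4)]] by blast
  ultimately show False
    using core_curve_lift_not_closed[OF assms(1,4)] unfolding h(2) by blast
qed

end
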